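(* Let $N\ge 1$ and let $(A_k)_{1\le k\le N}$ be events on a probability space $(\Omega,\mathcal F,\mathbb P)$, with the coefficient $\varphi(\cdot)$ fixed by one of the two conventions (ambient: $\varphi=\varphi_A$; or finite restricted: $\varphi=\varphi_N$). Then for each integer $L\ge 2$, $$\mathbb P\Bigl(\bigcup_{k=1}^{N}A_k\Bigr)\ \ge\ 1-\exp\Bigl(-\tfrac12\bigl(S_N-T_{L-1}-\kappa_{N,L}\,\varphi(L+1)\bigr)_{+}\Bigr),$$ where $$S_N=\sum_{k=1}^N\mathbb P(A_k),\qquad T_{L-1}=\sum_{\substack{1\le i<j\le N\\ |i-j|\le L-1}}\mathbb P(A_i\cap A_j),\qquad \kappa_{N,L}=\Bigl\lceil\frac{N}{L}\Bigr\rceil+1.$$ The statement holds under each of the two conventions.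
   Context: Notation: $(x)_+=\max(x,0)$. For sub-$\sigma$-algebras $\mathcal A,\mathcal B\subseteq\mathcal F$, $\varphi(\mathcal A,\mathcal B)=\sup\{|\mathbb P(B\mid A)-\mathbb P(B)|: A\in\mathcal A,\ \mathbb P(A)>0,\ B\in\mathcal B\}$. For integers $a,b\ge1$, $\mathcal F_a^b=\sigma(A_j: a\le j\le b)$ (trivial if $a>b$) and $\mathcal F_a^\infty=\sigma(A_j: j\ge a)$. Ambient convention: the events are the first $N$ members of a sequence $(A_k)_{k\ge1}$, and $\varphi(n)=\varphi_A(n):=\sup_{k\ge1}\varphi(\mathcal F_1^k,\mathcal F_{k+n}^\infty)$. Finite restricted convention: $\varphi(n)=\varphi_N(n):=\sup_{1\le k\le N}\varphi(\mathcal F_1^k,\mathcal F_{k+n}^N)$, where $\mathcal F_a^N$ is trivial when $a>N$. *)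

theory Defs
  imports "HOL-Probability.Probability"
begin

text \<open>Sub-\<open>\<sigma>\<close>-algebras are represented by their families of measurable sets. The supremum
  below is a supremum of reals; for sub-\<open>\<sigma>\<close>-algebras of a probability space it ranges over a
  nonempty subset of \<open>[0, 1]\<close>, and the same holds for the suprema over \<open>k\<close> further down.\<close>

definition phi_coeff :: "'a measure \<Rightarrow> 'a set set \<Rightarrow> 'a set set \<Rightarrow> real" where
  "phi_coeff M \<A> \<B> =
     Sup {\<bar>\<P>(\<omega> in M. \<omega> \<in> B \<bar> \<omega> \<in> A) - measure M B\<bar> | A B.
            A \<in> \<A> \<and> measure M A > 0 \<and> B \<in> \<B>}"

text \<open>For \<open>a > b\<close> the generator is empty, so \<open>sigma_between\<close> is the trivial \<open>\<sigma>\<close>-algebra.\<close>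

definition sigma_between :: "'a measure \<Rightarrow> (nat \<Rightarrow> 'a set) \<Rightarrow> nat \<Rightarrow> nat \<Rightarrow> 'a set set" where
  "sigma_between M A a b = sigma_sets (space M) (A ` {a..b})"

definition sigma_from :: "'a measure \<Rightarrow> (nat \<Rightarrow> 'a set) \<Rightarrow> nat \<Rightarrow> 'a set set" where
  "sigma_from M A a = sigma_sets (space M) (A ` {a..})"

definition phi_ambient :: "'a measure \<Rightarrow> (nat \<Rightarrow> 'a set) \<Rightarrow> nat \<Rightarrow> real" where
  "phi_ambient M A n =
     (SUP k\<in>{1..}. phi_coeff M (sigma_between M A 1 k) (sigma_from M A (k + n)))"

definition phi_finite :: "'a measure \<Rightarrow> (nat \<Rightarrow> 'a set) \<Rightarrow> nat \<Rightarrow> nat \<Rightarrow> real" where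
  "phi_finite M A N n =
     (SUP k\<in>{1..N}. phi_coeff M (sigma_between M A 1 k) (sigma_between M A (k + n) N))"

definition S_sum :: "'a measure \<Rightarrow> (nat \<Rightarrow> 'a set) \<Rightarrow> nat \<Rightarrow> real" where
  "S_sum M A N = (\<Sum>k=1..N. measure M (A k))"

text \<open>\<open>T_sum M A N d\<close> is \<open>T\<^sub>d\<close> for the first \<open>N\<close> events.\<close>

definition T_sum :: "'a measure \<Rightarrow> (nat \<Rightarrow> 'a set) \<Rightarrow> nat \<Rightarrow> nat \<Rightarrow> real" where
  "T_sum M A N d =
     (\<Sum>(i, j)\<in>{(i, j). 1 \<le> i \<and> i < j \<and> j \<le> N \<and> \<bar>int i - int j\<bar> \<le> int d}.
        measure M (A i \<inter> A j))"

definition kappa :: "nat \<Rightarrow> nat \<Rightarrow> int" where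
  "kappa N L = \<lceil>real N / real L\<rceil> + 1"

end

theory Submission
  imports Defs
begin

text \<open>Cut \<open>{1..N}\<close> into consecutive blocks of length \<open>L\<close>. Two blocks of the same parity are
  separated by a full block, that is by an index gap of at least \<open>L + 1\<close>, so that within one parity
  class each block contributes a factor at most \<open>1 - (p - \<phi> (L + 1)) \<le> exp (- (p - \<phi> (L + 1)))\<close>
  to the probability that no event occurs, \<open>p\<close> being the probability of the union over the block.
  One of the two parity classes carries at least half of the total exponent, whence the factor
  \<open>1/2\<close>, and Bonferroni's
  inequality inside each block bounds the sum of the \<open>p\<close> from below by \<open>S\<^sub>N - T\<^bsub>L-1\<^esub>\<close>.\<close>

section \<open>Mixing coefficients as bounds on conditional probabilities\<close>

context prob_space
begin

text \<open>Serves to bound the suprema, hence the arbitrary predicates: a non-measurable set has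
  measure 0, and a zero denominator makes the quotient 0.\<close>

lemma abs_cond_prob_diff_le_1: "\<bar>\<P>(\<omega> in M. P \<omega> \<bar> Q \<omega>) - prob B\<bar> \<le> 1"
proof -
  have "\<P>(\<omega> in M. P \<omega> \<bar> Q \<omega>) \<le> 1"
  proof (cases "{\<omega> \<in> space M. P \<omega> \<and> Q \<omega>} \<in> events \<and> {\<omega> \<in> space M. Q \<omega>} \<in> events")
    case True
    then have "prob {\<omega> \<in> space M. P \<omega> \<and> Q \<omega>} \<le> prob {\<omega> \<in> space M. Q \<omega>}"
      by (intro finite_measure_mono) auto
    then show ?thesis
      by (simp add: cond_prob_def divide_le_eq_1 order.strict_iff_order)
  next
    case False
    then show ?thesis
      by (auto simp: cond_prob_def measure_notin_sets)
  qed
  moreover have "0 \<le> \<P>(\<omega> in M. P \<omega> \<bar> Q \<omega>)"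
    by (simp add: cond_prob_def)
  ultimately show ?thesis
    using prob_le_1[of B] measure_nonneg[of M B] by linarith
qed

lemma abs_cond_prob_diff_le_phi_coeff:
  assumes "C \<in> \<A>" "prob C > 0" "B \<in> \<B>"
  shows "\<bar>\<P>(\<omega> in M. \<omega> \<in> B \<bar> \<omega> \<in> C) - prob B\<bar> \<le> phi_coeff M \<A> \<B>"
  unfolding phi_coeff_def
proof (rule cSup_upper)
  show "bdd_above {\<bar>\<P>(\<omega> in M. \<omega> \<in> B \<bar> \<omega> \<in> A) - prob B\<bar> |A B. A \<in> \<A> \<and> 0 < prob A \<and> B \<in> \<B>}"
    by (rule bdd_aboveI[of _ 1]) (use abs_cond_prob_diff_le_1 in blast)
qed (use assms in blast)

text \<open>The members \<open>C\<close> and \<open>B\<close> witness that the supremum is over a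
  nonempty set.\<close>

lemma phi_coeff_le_1:
  assumes "C \<in> \<A>" "prob C > 0" "B \<in> \<B>"
  shows "phi_coeff M \<A> \<B> \<le> 1"
  unfolding phi_coeff_def
  by (rule cSup_least) (use assms abs_cond_prob_diff_le_1 in blast)+

lemma space_in_sigma_between: "space M \<in> sigma_between M A a b"
  by (simp add: sigma_between_def sigma_sets_top)

lemma space_in_sigma_from: "space M \<in> sigma_from M A a"
  by (simp add: sigma_from_def sigma_sets_top)

lemma UN_in_sigma_between:
  assumes "finite I" "I \<subseteq> {a..b}" "\<And>k. k \<in> I \<Longrightarrow> A k \<in> events"
  shows "(\<Union>k\<in>I. A k) \<in> sigma_between M A a b"
  using assms unfolding sigma_between_def
proof (induction I rule: finite_induct)
  case empty
  then show ?case by (simp add: sigma_sets.Empty)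
next
  case (insert k I)
  then have "A k \<in> sigma_sets (space M) (A ` {a..b})"
    by (intro sigma_sets.Basic) auto
  with insert show ?case
    by (auto intro!: sigma_sets_Un)
qed

text \<open>The future is cut off at \<open>N\<close> to match the shape of the finite convention;
  monotonicity of generated \<sigma>-algebras puts it inside the infinite future.\<close>

lemma phi_ambient_ge:
  assumes "k \<ge> 1" "C \<in> sigma_between M A 1 k" "prob C > 0" "B \<in> sigma_between M A (k + n) N"
  shows "\<bar>\<P>(\<omega> in M. \<omega> \<in> B \<bar> \<omega> \<in> C) - prob B\<bar> \<le> phi_ambient M A n"
proof -
  have "B \<in> sigma_from M A (k + n)"
    using assms(4) sigma_sets_mono'[of "A ` {k + n..N}" "A ` {k + n..}" "space M"]
    by (force simp: sigma_between_def sigma_from_def)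
  then have "\<bar>\<P>(\<omega> in M. \<omega> \<in> B \<bar> \<omega> \<in> C) - prob B\<bar>
      \<le> phi_coeff M (sigma_between M A 1 k) (sigma_from M A (k + n))"
    using assms by (intro abs_cond_prob_diff_le_phi_coeff)
  also have "\<dots> \<le> phi_ambient M A n"
    unfolding phi_ambient_def
  proof (rule cSUP_upper)
    \<comment> \<open>Infinitely many \<open>k\<close> enter here; the uniform bound 1 requires a
      pair from the two families, namely the whole space twice.\<close>
    show "bdd_above ((\<lambda>k. phi_coeff M (sigma_between M A 1 k) (sigma_from M A (k + n))) ` {1..})"
      by (rule bdd_aboveI2[of _ _ 1])
        (rule phi_coeff_le_1[OF space_in_sigma_between _ space_in_sigma_from], simp add: prob_space)
  qed (use assms in simp)
  finally show ?thesis .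
qed

lemma phi_finite_ge:
  assumes "k \<ge> 1" "k \<le> N" "C \<in> sigma_between M A 1 k" "prob C > 0"
    "B \<in> sigma_between M A (k + n) N"
  shows "\<bar>\<P>(\<omega> in M. \<omega> \<in> B \<bar> \<omega> \<in> C) - prob B\<bar> \<le> phi_finite M A N n"
proof -
  have "\<bar>\<P>(\<omega> in M. \<omega> \<in> B \<bar> \<omega> \<in> C) - prob B\<bar>
      \<le> phi_coeff M (sigma_between M A 1 k) (sigma_between M A (k + n) N)"
    using assms by (intro abs_cond_prob_diff_le_phi_coeff)
  also have "\<dots> \<le> phi_finite M A N n"
    unfolding phi_finite_def by (rule cSUP_upper) (use assms in auto)
  finally show ?thesis .
qed

section \<open>Bonferroni's inequality and the exponential bound\<close>

text \<open>Each pair is charged to its larger index, so the induction adds a new maximum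
  \<open>b\<close>: inclusion-exclusion for \<open>A b\<close> and the earlier union, then the union
  bound on their intersection.\<close>

lemma bonferroni_lower:
  fixes I :: "nat set"
  assumes "finite I" "\<And>k. k \<in> I \<Longrightarrow> A k \<in> events"
  shows "(\<Sum>k\<in>I. prob (A k) - (\<Sum>i\<in>{i\<in>I. i < k}. prob (A i \<inter> A k))) \<le> prob (\<Union>k\<in>I. A k)"
  using assms
proof (induction I rule: finite_linorder_max_induct)
  case empty
  then show ?case by simp
next
  case (insert b I)
  have U: "(\<Union>k\<in>I. A k) \<in> events"
    using insert by (intro sets.finite_UN) auto
  have "prob (A b \<inter> (\<Union>k\<in>I. A k)) = prob (\<Union>k\<in>I. A k \<inter> A b)"
    by (rule arg_cong[of _ _ prob]) auto
  also have "\<dots> \<le> (\<Sum>k\<in>I. prob (A k \<inter> A b))"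
    using insert by (intro finite_measure_subadditive_finite) auto
  finally have le: "prob (A b \<inter> (\<Union>k\<in>I. A k)) \<le> (\<Sum>k\<in>I. prob (A k \<inter> A b))" .
  \<comment> \<open>As \<open>b\<close> is the maximum, its inner sum runs over all of
    \<open>I\<close> and the other inner sums do not change.\<close>
  have "{i \<in> insert b I. i < b} = I"
    using insert by auto
  moreover have "{i \<in> insert b I. i < k} = {i \<in> I. i < k}" if "k \<in> I" for k
    using insert that by (auto dest: order.strict_trans)
  ultimately have "(\<Sum>k\<in>insert b I. prob (A k) - (\<Sum>i\<in>{i\<in>insert b I. i < k}. prob (A i \<inter> A k)))
      = prob (A b) - (\<Sum>k\<in>I. prob (A k \<inter> A b))
        + (\<Sum>k\<in>I. prob (A k) - (\<Sum>i\<in>{i\<in>I. i < k}. prob (A i \<inter> A k)))"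
    using insert by (subst sum.insert) (auto intro!: sum.cong)
  also have "\<dots> \<le> prob (A b) - prob (A b \<inter> (\<Union>k\<in>I. A k)) + prob (\<Union>k\<in>I. A k)"
    using insert le by simp
  also have "\<dots> = prob (A b \<union> (\<Union>k\<in>I. A k))"
    using insert U by (subst finite_measure_Union') (auto simp: finite_measure_Diff' Int_commute)
  finally show ?case by simp
qed

text \<open>The second assumption bounds the conditional probability of \<open>B j\<close> given the
  past from below, multiplied out so that it also makes sense for a past of probability 0.\<close>

lemma prob_avoid_le_exp:
  fixes B :: "nat \<Rightarrow> 'a set"
  assumes "\<And>j. B j \<in> events"
    and "\<And>j. prob (space M - (\<Union>i<j. B i)) * (prob (B j) - \<epsilon>)
                \<le> prob ((space M - (\<Union>i<j. B i)) \<inter> B j)"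
  shows "prob (space M - (\<Union>i<n. B i)) \<le> exp (- (\<Sum>j<n. prob (B j) - \<epsilon>))"
proof (induction n)
  case 0
  then show ?case by simp
next
  case (Suc n)
  let ?E = "space M - (\<Union>i<n. B i)" and ?x = "prob (B n) - \<epsilon>"
  have E: "?E \<in> events"
    using assms(1) by auto
  have "space M - (\<Union>i<Suc n. B i) = ?E - B n"
    by (auto simp: lessThan_Suc)
  then have "prob (space M - (\<Union>i<Suc n. B i)) = prob ?E - prob (?E \<inter> B n)"
    using E assms(1) by (simp add: finite_measure_Diff')
  also have "\<dots> \<le> prob ?E * (1 - ?x)"
    using assms(2)[of n] by (simp add: right_diff_distrib)
  \<comment> \<open>\<open>1 + y \<le> exp y\<close> at \<open>y = - ?x\<close>, valid for either
    sign of \<open>?x\<close>.\<close>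
  also have "\<dots> \<le> prob ?E * exp (- ?x)"
    using exp_ge_add_one_self[of "- ?x"] by (intro mult_left_mono measure_nonneg) linarith
  also have "\<dots> \<le> exp (- (\<Sum>j<n. prob (B j) - \<epsilon>)) * exp (- ?x)"
    using Suc by (intro mult_right_mono) auto
  also have "\<dots> = exp (- (\<Sum>j<Suc n. prob (B j) - \<epsilon>))"
    by (simp add: exp_add[symmetric])
  finally show ?case .
qed

end

section \<open>Blocks of consecutive indices\<close>

text \<open>Indices start at 1 but block numbers at 0: for \<open>L > 0\<close>, block
  \<open>r\<close> is \<open>{r * L + 1..(r + 1) * L}\<close> cut off at \<open>N\<close>, hence
  empty once \<open>r * L \<ge> N\<close>. As fibres of a map, the blocks partition
  \<open>{1..N}\<close>.\<close>

definition block :: "nat \<Rightarrow> nat \<Rightarrow> nat \<Rightarrow> nat set" where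
  "block N L r = {k\<in>{1..N}. (k - 1) div L = r}"

lemma block_subset: "block N L r \<subseteq> {1..N}"
  by (auto simp: block_def)

lemma finite_block [simp]: "finite (block N L r)"
  using finite_subset[OF block_subset] by blast

lemma block_bounds:
  assumes "k \<in> block N L r" "L > 0"
  shows "r * L + 1 \<le> k" "k \<le> (r + 1) * L"
proof -
  have k: "k \<ge> 1" "(k - 1) div L = r"
    using assms by (auto simp: block_def)
  have "r * L \<le> k - 1"
    using k(2) by (metis div_times_less_eq_dividend)
  then show "r * L + 1 \<le> k"
    using k(1) by linarith
  have "k - 1 < (r + 1) * L"
    using k(2) assms(2) by (metis Suc_eq_plus1 dividend_less_div_times mult_Suc add.commute)
  then show "k \<le> (r + 1) * L"
    by linarith
qed

text \<open>Groups the pairs by their larger index, as in the Bonferroni bound; \<open>i < k\<close>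
  makes the truncated subtraction exact.\<close>

lemma T_sum_eq:
  "T_sum M A N d = (\<Sum>k=1..N. \<Sum>i | 1 \<le> i \<and> i < k \<and> k - i \<le> d. measure M (A i \<inter> A k))"
proof -
  have "(\<Sum>k=1..N. \<Sum>i | 1 \<le> i \<and> i < k \<and> k - i \<le> d. measure M (A i \<inter> A k))
     = (\<Sum>(k, i)\<in>(SIGMA k:{1..N}. {i. 1 \<le> i \<and> i < k \<and> k - i \<le> d}). measure M (A i \<inter> A k))"
    by (rule sum.Sigma) auto
  also have "\<dots> = T_sum M A N d"
    unfolding T_sum_def
    by (rule sum.reindex_bij_witness[of _ "\<lambda>(i, k). (k, i)" "\<lambda>(k, i). (i, k)"]) auto
  finally show ?thesis by simp
qed

text \<open>Indices in one block differ by at most \<open>L - 1\<close>, so every pair charged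
  inside a block occurs in \<open>T_sum\<close>; close pairs straddling two blocks only lower the
  left side.\<close>

lemma (in prob_space) sum_prob_blocks_ge:
  assumes "\<And>k. 1 \<le> k \<Longrightarrow> k \<le> N \<Longrightarrow> A k \<in> events" "L > 0" "N \<le> m * L"
  shows "S_sum M A N - T_sum M A N (L - 1) \<le> (\<Sum>r<m. prob (\<Union>k\<in>block N L r. A k))"
proof -
  let ?f = "\<lambda>k. prob (A k) - (\<Sum>i | 1 \<le> i \<and> i < k \<and> k - i \<le> L - 1. prob (A i \<inter> A k))"
  have "S_sum M A N - T_sum M A N (L - 1) = (\<Sum>k=1..N. ?f k)"
    by (simp add: S_sum_def T_sum_eq sum_subtractf)
  also have "\<dots> = (\<Sum>r<m. \<Sum>k\<in>block N L r. ?f k)"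
    unfolding block_def using assms(2,3)
    by (intro sum.group[symmetric]) (auto intro!: less_mult_imp_div_less)
  also have "\<dots> \<le> (\<Sum>r<m. prob (\<Union>k\<in>block N L r. A k))"
  proof (rule sum_mono)
    fix r
    have "(\<Sum>k\<in>block N L r. ?f k)
        \<le> (\<Sum>k\<in>block N L r. prob (A k) - (\<Sum>i\<in>{i\<in>block N L r. i < k}. prob (A i \<inter> A k)))"
    proof (intro sum_mono diff_left_mono sum_mono2)
      fix k
      assume k: "k \<in> block N L r"
      show "{i \<in> block N L r. i < k} \<subseteq> {i. 1 \<le> i \<and> i < k \<and> k - i \<le> L - 1}"
        using block_bounds[OF k assms(2)] block_bounds[of _ N L r] assms(2) by fastforce
    qed auto
    also have "\<dots> \<le> prob (\<Union>k\<in>block N L r. A k)"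
      using assms(1) by (intro bonferroni_lower) (auto simp: block_def)
    finally show "(\<Sum>k\<in>block N L r. ?f k) \<le> prob (\<Union>k\<in>block N L r. A k)" .
  qed
  finally show ?thesis .
qed

text \<open>\<open>mix\<close> is the form in which either convention enters. Avoiding every event
  implies avoiding the blocks \<open>p\<close>, \<open>p + 2\<close>, and so on, to which the
  exponential bound applies.\<close>

lemma (in prob_space) avoid_blocks_of_parity:
  assumes A: "\<And>k. 1 \<le> k \<Longrightarrow> k \<le> N \<Longrightarrow> A k \<in> events"
    and L: "L > 0" and "\<epsilon> \<ge> 0"
    and mix: "\<And>k C B. 1 \<le> k \<Longrightarrow> k \<le> N \<Longrightarrow> C \<in> sigma_between M A 1 k \<Longrightarrow> prob C > 0 \<Longrightarrow>
      B \<in> sigma_between M A (k + (L + 1)) N \<Longrightarrow>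
      \<bar>\<P>(\<omega> in M. \<omega> \<in> B \<bar> \<omega> \<in> C) - prob B\<bar> \<le> \<epsilon>"
  shows "1 - prob (\<Union>k\<in>{1..N}. A k)
    \<le> exp (- (\<Sum>j<n. prob (\<Union>k\<in>block N L (2 * j + p). A k) - \<epsilon>))"
proof -
  define B where "B j = (\<Union>k\<in>block N L (2 * j + p). A k)" for j
  have B: "B j \<in> events" for j
    unfolding B_def using A by (intro sets.finite_UN) (auto simp: block_def)
  have step: "prob (space M - (\<Union>i<j. B i)) * (prob (B j) - \<epsilon>)
      \<le> prob ((space M - (\<Union>i<j. B i)) \<inter> B j)" for j
  proof -
    let ?C = "space M - (\<Union>i<j. B i)"
    \<comment> \<open>Degenerate cases first: a null past, an empty block (where
      \<open>k \<le> N\<close> below could fail), and the first block, which has no past.\<close>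
    consider "prob ?C = 0" | "block N L (2 * j + p) = {}" | "j = 0"
      | "prob ?C > 0" "block N L (2 * j + p) \<noteq> {}" "j > 0"
      using measure_nonneg[of M ?C] by (metis gr0I order_le_less)
    then show ?thesis
    proof cases
      case 1
      then show ?thesis by simp
    next
      case 2
      then show ?thesis using \<open>\<epsilon> \<ge> 0\<close> by (simp add: B_def)
    next
      case 3
      then show ?thesis using \<open>\<epsilon> \<ge> 0\<close> B[of 0] sets.sets_into_space[OF B[of 0]]
        by (simp add: prob_space Int_absorb1)
    next
      case 4
      \<comment> \<open>The right end of block \<open>2 * j + p - 2\<close>, the latest one in the
        past. Block \<open>2 * j + p\<close> starts at \<open>k + L + 1\<close>, so the gap is
        exactly \<open>L + 1\<close>.\<close>
      define k where "k = (2 * j + p - 1) * L"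
      have k_next: "(2 * j + p) * L = k + L"
        using \<open>j > 0\<close> by (cases "2 * j + p") (auto simp: k_def)
      obtain k' where "k' \<in> block N L (2 * j + p)"
        using 4 by blast
      then have "k \<le> N"
        using block_bounds(1)[of k' N L "2 * j + p"] k_next L by (auto simp: block_def)
      have "k \<ge> 1"
        using \<open>j > 0\<close> L by (simp add: k_def Suc_le_eq)
      have past: "block N L (2 * i + p) \<subseteq> {1..k}" if "i < j" for i
      proof
        fix l assume l: "l \<in> block N L (2 * i + p)"
        have "l \<le> (2 * i + p + 1) * L"
          by (rule block_bounds[OF l L])
        also have "\<dots> \<le> k"
          unfolding k_def using that by (intro mult_right_mono) auto
        finally show "l \<in> {1..k}"
          using l by (auto simp: block_def)
      qed
      have "(\<Union>i<j. B i) = (\<Union>l\<in>(\<Union>i<j. block N L (2 * i + p)). A l)"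
        by (auto simp: B_def)
      also have "\<dots> \<in> sigma_between M A 1 k"
      proof (rule UN_in_sigma_between)
        show "(\<Union>i<j. block N L (2 * i + p)) \<subseteq> {1..k}"
          using past by blast
        show "A l \<in> events" if "l \<in> (\<Union>i<j. block N L (2 * i + p))" for l
          using that A by (auto simp: block_def)
      qed simp
      finally have C: "?C \<in> sigma_between M A 1 k"
        unfolding sigma_between_def by (rule sigma_sets.Compl)
      have future: "block N L (2 * j + p) \<subseteq> {k + (L + 1)..N}"
      proof
        fix l assume l: "l \<in> block N L (2 * j + p)"
        show "l \<in> {k + (L + 1)..N}"
          using block_bounds(1)[OF l L] l k_next by (auto simp: block_def)
      qed
      have "B j \<in> sigma_between M A (k + (L + 1)) N"
        unfolding B_def using future A
        by (intro UN_in_sigma_between) (auto simp: block_def)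
      from mix[OF \<open>k \<ge> 1\<close> \<open>k \<le> N\<close> C 4(1) this]
      have "prob (B j) - \<epsilon> \<le> \<P>(\<omega> in M. \<omega> \<in> B j \<bar> \<omega> \<in> ?C)"
        by linarith
      also have "\<dots> = prob (?C \<inter> B j) / prob ?C"
        unfolding cond_prob_def
        by (intro arg_cong2[of _ _ _ _ "(/)"] arg_cong[of _ _ prob]) auto
      finally show ?thesis
        using 4(1) by (simp add: pos_le_divide_eq mult.commute)
    qed
  qed
  have "1 - prob (\<Union>k\<in>{1..N}. A k) = prob (space M - (\<Union>k\<in>{1..N}. A k))"
    using A by (intro prob_compl[symmetric] sets.finite_UN) auto
  also have "\<dots> \<le> prob (space M - (\<Union>i<n. B i))"
  proof (rule finite_measure_mono)
    show "space M - (\<Union>k\<in>{1..N}. A k) \<subseteq> space M - (\<Union>i<n. B i)"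
      using block_subset[of N L] by (force simp: B_def)
    show "space M - (\<Union>i<n. B i) \<in> events"
      using B by auto
  qed
  also have "\<dots> \<le> exp (- (\<Sum>j<n. prob (B j) - \<epsilon>))"
    using B step by (intro prob_avoid_le_exp)
  finally show ?thesis
    by (simp add: B_def)
qed

section \<open>Balancing the two parity classes\<close>

lemma sum_even_odd:
  fixes f :: "nat \<Rightarrow> 'a::comm_monoid_add"
  shows "(\<Sum>j<n. f (2 * j)) + (\<Sum>j<n. f (2 * j + 1)) = (\<Sum>r<2 * n. f r)"
  by (induction n) (simp_all add: algebra_simps)

theorem theorem3p4:
  fixes M :: "'a measure" and A :: "nat \<Rightarrow> 'a set" and N L :: nat and \<phi> :: "nat \<Rightarrow> real"
  assumes "prob_space M"
    and "N \<ge> 1"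
    and "\<And>k. 1 \<le> k \<Longrightarrow> k \<le> N \<Longrightarrow> A k \<in> sets M"
    and "((\<forall>k\<ge>1. A k \<in> sets M) \<and> \<phi> = phi_ambient M A) \<or> \<phi> = phi_finite M A N"
    and "L \<ge> 2"
  shows "measure M (\<Union>k\<in>{1..N}. A k) \<ge>
    1 - exp (- (1/2) * max (S_sum M A N - T_sum M A N (L - 1)
                              - of_int (kappa N L) * \<phi> (L + 1)) 0)"
proof -
  interpret prob_space M by fact
  let ?P = "measure M (\<Union>k\<in>{1..N}. A k)"
  define \<epsilon> where "\<epsilon> = \<phi> (L + 1)"
  define D where "D = S_sum M A N - T_sum M A N (L - 1) - of_int (kappa N L) * \<epsilon>"
  have L: "L > 0"
    using \<open>L \<ge> 2\<close> by simp
  have mix: "\<bar>\<P>(\<omega> in M. \<omega> \<in> B \<bar> \<omega> \<in> C) - prob B\<bar> \<le> \<epsilon>"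
    if "1 \<le> k" "k \<le> N" "C \<in> sigma_between M A 1 k" "prob C > 0"
      "B \<in> sigma_between M A (k + (L + 1)) N" for k C B
    using assms(4) phi_ambient_ge[of k C A B "L + 1" N] phi_finite_ge[of k N C A B "L + 1"] that
    by (auto simp: \<epsilon>_def)
  \<comment> \<open>Take \<open>k = 1\<close> and the whole space for both sets: the deviation is
    0.\<close>
  have "\<epsilon> \<ge> 0"
    using mix[OF order.refl \<open>N \<ge> 1\<close> space_in_sigma_between _ space_in_sigma_between]
    by (simp add: prob_space)
  \<comment> \<open>The number of blocks per parity: half of \<lceil>N/L\<rceil>, rounded up. Then
    \<open>2 * n\<close> blocks cover \<open>{1..N}\<close>, and rounding costs at most one extra
    block, which the \<open>+ 1\<close> in \<open>kappa\<close> absorbs.\<close>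
  define n where "n = (nat \<lceil>real N / real L\<rceil> + 1) div 2"
  have "real N / real L \<le> real (2 * n)"
    unfolding n_def by linarith
  then have "real N \<le> real (2 * n * L)"
    using L by (simp add: divide_le_eq)
  then have N_le: "N \<le> 2 * n * L"
    by linarith
  have "0 \<le> \<lceil>real N / real L\<rceil>"
    by (simp add: order.strict_trans2[of _ 0])
  then have "int (2 * n) \<le> kappa N L"
    unfolding n_def kappa_def by linarith
  then have n_le: "2 * real n \<le> of_int (kappa N L)"
    by linarith
  define q where "q r = prob (\<Union>k\<in>block N L r. A k)" for r
  have parity: "1 - ?P \<le> exp (- (\<Sum>j<n. q (2 * j + p) - \<epsilon>))" for p
    unfolding q_def using assms(3) L \<open>\<epsilon> \<ge> 0\<close> mix by (rule avoid_blocks_of_parity)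
  have "D \<le> (\<Sum>r<2 * n. q r) - 2 * real n * \<epsilon>"
    unfolding D_def q_def using assms(3) L N_le mult_right_mono[OF n_le \<open>\<epsilon> \<ge> 0\<close>]
    by (intro diff_mono sum_prob_blocks_ge) auto
  \<comment> \<open>The \<open>+ 0\<close> keeps both sums instances of one pattern in
    \<open>p\<close>.\<close>
  also have "\<dots> = (\<Sum>j<n. q (2 * j + 0) - \<epsilon>) + (\<Sum>j<n. q (2 * j + 1) - \<epsilon>)"
    by (simp add: sum_even_odd[symmetric] sum_subtractf)
  finally have "D / 2 \<le> (\<Sum>j<n. q (2 * j + 0) - \<epsilon>) \<or> D / 2 \<le> (\<Sum>j<n. q (2 * j + 1) - \<epsilon>)"
    by linarith
  then obtain p where "D / 2 \<le> (\<Sum>j<n. q (2 * j + p) - \<epsilon>)"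
    by blast
  then have "1 - ?P \<le> exp (- (D / 2))"
    using parity[of p] by (meson exp_le_cancel_iff le_imp_neg_le order_trans)
  \<comment> \<open>Covers negative \<open>D\<close>, where the positive part vanishes and the bound
    is 1.\<close>
  moreover have "1 - ?P \<le> 1"
    by simp
  ultimately have "1 - ?P \<le> exp (- (1/2) * max D 0)"
    by (simp add: max_def)
  then show ?thesis
    unfolding D_def \<epsilon>_def by linarith
qed

end
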